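(* Let $Q$ be a rack. Then $\zeta_Q=\mathrm{con}_{Z(\mathrm{Dis}(Q))}\cap\sigma_Q$.
   Context: A left quasigroup is a nonempty set $Q$ with two binary operations $*,\backslash$ satisfying $x\backslash(x*y)=y=x*(x\backslash y)$; write $L_a(b)=a*b$, a permutation of $Q$. A rack is a left quasigroup satisfying $x*(y*z)=(x*y)*(x*z)$. $\mathrm{LMlt}(Q)=\langle L_a:a\in Q\rangle$ and $\mathrm{Dis}(Q)=\langle L_aL_b^{-1}:a,b\in Q\rangle$, with center $Z(\mathrm{Dis}(Q))$. For a subgroup $N\le\mathrm{Dis}(Q)$ normal in $\mathrm{LMlt}(Q)$, $\mathrm{con}_N=\{(a,b)\in Q^2: L_aL_b^{-1}\in N\}$. The equivalence $\sigma_Q$ is defined by $a\,\sigma_Q\,b\Leftrightarrow \mathrm{Dis}(Q)_a=\mathrm{Dis}(Q)_b$, where $\mathrm{Dis}(Q)_x$ is the stabilizer of $x$ in $\mathrm{Dis}(Q)$. For congruences $\alpha,\beta,\delta$ (equivalences compatible with all operations) of an algebraic structure $A$, $C(\alpha,\beta;\delta)$ means: for every $n\ge0$, every $(n+1)$-ary term operation $t$, every $a\,\alpha\,b$ and all $u_i\,\beta\,v_i$ ($i=1,\dots,n$), $t(a,u_1,\dots,u_n)\,\delta\,t(a,v_1,\dots,v_n)$ implies $t(b,u_1,\dots,u_n)\,\delta\,t(b,v_1,\dots,v_n)$. The center $\zeta_A$ is the largest congruence $\zeta$ of $A$ with $C(\zeta,1_A;0_A)$, where $0_A$ is the equality relation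 and $1_A=A\times A$. For racks, terms and congruences are taken with respect to both $*$ and $\backslash$. *)

theory Defs
  imports "HOL-Algebra.Generated_Groups" "HOL-Algebra.Group_Action" "HOL-Algebra.Bij"
begin

section \<open>Left quasigroups and racks\<close>

record 'a lq = "'a partial_object" +
  star :: "'a \<Rightarrow> 'a \<Rightarrow> 'a" (infixl \<open>\<star>\<index>\<close> 70)
  ldiv :: "'a \<Rightarrow> 'a \<Rightarrow> 'a" (infixl \<open>\<setminus>\<index>\<close> 70)

locale left_quasigroup =
  fixes Q (structure)
  assumes nonempty: "carrier Q \<noteq> {}"
    and star_closed: "\<lbrakk>x \<in> carrier Q; y \<in> carrier Q\<rbrakk> \<Longrightarrow> x \<star> y \<in> carrier Q"
    and ldiv_closed: "\<lbrakk>x \<in> carrier Q; y \<in> carrier Q\<rbrakk> \<Longrightarrow> x \<setminus> y \<in> carrier Q"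
    and ldiv_star: "\<lbrakk>x \<in> carrier Q; y \<in> carrier Q\<rbrakk> \<Longrightarrow> x \<setminus> (x \<star> y) = y"
    and star_ldiv: "\<lbrakk>x \<in> carrier Q; y \<in> carrier Q\<rbrakk> \<Longrightarrow> x \<star> (x \<setminus> y) = y"

locale rack = left_quasigroup +
  assumes left_distrib:
    "\<lbrakk>x \<in> carrier Q; y \<in> carrier Q; z \<in> carrier Q\<rbrakk>
      \<Longrightarrow> x \<star> (y \<star> z) = (x \<star> y) \<star> (x \<star> z)"

section \<open>The displacement group and the induced relations\<close>

text \<open>Left translations are made extensional so that they are elements of \<^term>\<open>BijGroup (carrier Q)\<close>.\<close>

definition ltrans :: "('a, 'm) lq_scheme \<Rightarrow> 'a \<Rightarrow> 'a \<Rightarrow> 'a" where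
  "ltrans Q a = (\<lambda>x \<in> carrier Q. a \<star>\<^bsub>Q\<^esub> x)"

lemma (in left_quasigroup) ltrans_in_BijGroup:
  assumes "a \<in> carrier Q"
  shows "ltrans Q a \<in> carrier (BijGroup (carrier Q))"
proof -
  have "bij_betw (ltrans Q a) (carrier Q) (carrier Q)"
    by (rule bij_betw_byWitness[where f' = "\<lambda>y. a \<setminus> y"])
       (use assms in \<open>auto simp: ltrans_def star_closed ldiv_closed ldiv_star star_ldiv\<close>)
  then show ?thesis
    by (simp add: BijGroup_def Bij_def ltrans_def)
qed

definition ltrans_quot :: "('a, 'm) lq_scheme \<Rightarrow> 'a \<Rightarrow> 'a \<Rightarrow> 'a \<Rightarrow> 'a" where
  "ltrans_quot Q a b =
    ltrans Q a \<otimes>\<^bsub>BijGroup (carrier Q)\<^esub> inv\<^bsub>BijGroup (carrier Q)\<^esub> (ltrans Q b)"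

definition Dis :: "('a, 'm) lq_scheme \<Rightarrow> ('a \<Rightarrow> 'a) monoid" where
  "Dis Q = subgroup_generated (BijGroup (carrier Q))
             {ltrans_quot Q a b | a b. a \<in> carrier Q \<and> b \<in> carrier Q}"

definition group_center :: "('g, 'm) monoid_scheme \<Rightarrow> 'g set" where
  "group_center G = {z \<in> carrier G. \<forall>g \<in> carrier G. z \<otimes>\<^bsub>G\<^esub> g = g \<otimes>\<^bsub>G\<^esub> z}"

text \<open>The following relation is meant for subgroups \<open>N\<close> of \<open>Dis Q\<close> that are normal in the group
  generated by all left translations, such as the center of \<open>Dis Q\<close>.\<close>

definition con_rel :: "('a, 'm) lq_scheme \<Rightarrow> ('a \<Rightarrow> 'a) set \<Rightarrow> ('a \<times> 'a) set" where
  "con_rel Q N = {(a, b) \<in> carrier Q \<times> carrier Q. ltrans_quot Q a b \<in> N}"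

text \<open>\<open>Dis Q\<close> consists of permutations of \<open>carrier Q\<close>, so the action map is the identity.\<close>

definition sigma_rel :: "('a, 'm) lq_scheme \<Rightarrow> ('a \<times> 'a) set" where
  "sigma_rel Q = {(a, b) \<in> carrier Q \<times> carrier Q.
     stabilizer (Dis Q) (\<lambda>g. g) a = stabilizer (Dis Q) (\<lambda>g. g) b}"

section \<open>Terms, congruences and the center\<close>

datatype lq_term = Var nat | Star lq_term lq_term | Ldiv lq_term lq_term

primrec term_vars :: "lq_term \<Rightarrow> nat set" where
  "term_vars (Var i) = {i}"
| "term_vars (Star s t) = term_vars s \<union> term_vars t"
| "term_vars (Ldiv s t) = term_vars s \<union> term_vars t"

primrec term_op :: "('a, 'm) lq_scheme \<Rightarrow> lq_term \<Rightarrow> (nat \<Rightarrow> 'a) \<Rightarrow> 'a" where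
  "term_op Q (Var i) e = e i"
| "term_op Q (Star s t) e = term_op Q s e \<star>\<^bsub>Q\<^esub> term_op Q t e"
| "term_op Q (Ldiv s t) e = term_op Q s e \<setminus>\<^bsub>Q\<^esub> term_op Q t e"

definition congruence :: "('a, 'm) lq_scheme \<Rightarrow> ('a \<times> 'a) set \<Rightarrow> bool" where
  "congruence Q r \<longleftrightarrow> equiv (carrier Q) r \<and>
     (\<forall>a b c d. (a, b) \<in> r \<longrightarrow> (c, d) \<in> r \<longrightarrow>
        (a \<star>\<^bsub>Q\<^esub> c, b \<star>\<^bsub>Q\<^esub> d) \<in> r \<and> (a \<setminus>\<^bsub>Q\<^esub> c, b \<setminus>\<^bsub>Q\<^esub> d) \<in> r)"

text \<open>\<open>centralizes Q \<alpha> \<beta> \<delta>\<close> is the condition \<open>C(\<alpha>, \<beta>; \<delta>)\<close>. An \<open>(n+1)\<close>-ary term operation is given by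
  a term in the variables \<open>0, \<dots>, n\<close>, and \<open>u(0 := a)\<close> is the argument tuple \<open>(a, u 1, \<dots>, u n)\<close>.\<close>

definition centralizes ::
  "('a, 'm) lq_scheme \<Rightarrow> ('a \<times> 'a) set \<Rightarrow> ('a \<times> 'a) set \<Rightarrow> ('a \<times> 'a) set \<Rightarrow> bool" where
  "centralizes Q \<alpha> \<beta> \<delta> \<longleftrightarrow>
     (\<forall>n t a b u v. term_vars t \<subseteq> {0..n} \<longrightarrow> (a, b) \<in> \<alpha> \<longrightarrow> (\<forall>i \<in> {1..n}. (u i, v i) \<in> \<beta>) \<longrightarrow>
        (term_op Q t (u(0 := a)), term_op Q t (v(0 := a))) \<in> \<delta> \<longrightarrow>
        (term_op Q t (u(0 := b)), term_op Q t (v(0 := b))) \<in> \<delta>)"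

text \<open>The largest congruence with respect to inclusion.\<close>

definition center :: "('a, 'm) lq_scheme \<Rightarrow> ('a \<times> 'a) set" where
  "center Q = (GREATEST \<zeta>. congruence Q \<zeta> \<and>
     centralizes Q \<zeta> (carrier Q \<times> carrier Q) (Id_on (carrier Q)))"

end

theory Submission
  imports Defs
begin

text \<open>Write \<open>\<D>\<close> for the displacement group, \<open>\<Z>\<close> for its center and \<open>\<L> a\<close> for the left translation
  by \<open>a\<close>. The proof shows that \<open>con_rel Q \<Z> \<inter> sigma_rel Q\<close> contains every congruence that satisfies the
  centrality condition, and that it is itself such a congruence.

  The first half is a matter of finding the right terms. Every displacement \<open>d\<close> has the form
  \<open>x \<mapsto> t(x, u)\<close> for a term \<open>t\<close> with \<open>t(x, v) = x\<close> for other parameters \<open>v\<close>: in a product of factors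
  \<open>\<L> p \<cdot> \<iota> (\<L> q)\<close> let \<open>p\<close> take the place of \<open>q\<close>. So centrality turns \<open>d a = a\<close> into \<open>d b = b\<close>, and related
  elements have equal stabilizers (\<open>centralizes_stabilizer\<close>). The same idea applied to the terms
  \<open>x \<setminus> (p \<star> (q \<setminus> (x \<star> y)))\<close> shows that \<open>\<L> a\<close> and \<open>\<L> b\<close> conjugate the generators of \<open>\<D>\<close> in the same way,
  so that \<open>\<L> a \<cdot> \<iota> (\<L> b)\<close> is central (\<open>centralizes_quot_cent\<close>).

  The second half rests on the rack law, which makes \<open>\<L> (x \<star> y)\<close> the conjugate of \<open>\<L> y\<close> by \<open>\<L> x\<close>. Let \<open>a\<close>
  and \<open>b\<close> be related and let \<open>t\<close> be a term. By induction on \<open>t\<close>, replacing \<open>a\<close> with \<open>b\<close> multiplies the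
  translation by \<open>t(a, u)\<close> by a central element that is the same for all parameters \<open>u\<close>
  (\<open>term_ltrans_factor\<close>); the reason for this uniformity is that all translations induce the same
  automorphism of \<open>\<Z>\<close> (\<open>cent_conj_indep\<close>). A second induction on \<open>t\<close> shows that each equation
  \<open>d (t(a, u)) = t(a, v)\<close> with \<open>d \<in> \<D>\<close> remains true with \<open>b\<close> in place of \<open>a\<close>
  (\<open>term_disp_transfer\<close>). With \<open>d = 1\<close> this is the centrality condition. With \<open>u = v\<close> it compares the
  stabilizers of \<open>t(a, u)\<close> and \<open>t(b, u)\<close>, which gives the compatibility with the operations.\<close>

section \<open>Permutations of the underlying set\<close>

context left_quasigroup
begin

sublocale G: group "BijGroup (carrier Q)"
  by (rule group_BijGroup)

abbreviation perm_mult (infixl \<open>\<cdot>\<close> 70) where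
  "g \<cdot> h \<equiv> g \<otimes>\<^bsub>BijGroup (carrier Q)\<^esub> h"

abbreviation perm_inv (\<open>\<iota>\<close>) where
  "\<iota> g \<equiv> inv\<^bsub>BijGroup (carrier Q)\<^esub> g"

abbreviation perms (\<open>\<G>\<close>) where "\<G> \<equiv> carrier (BijGroup (carrier Q))"
abbreviation disps (\<open>\<D>\<close>) where "\<D> \<equiv> carrier (Dis Q)"
abbreviation cent (\<open>\<Z>\<close>) where "\<Z> \<equiv> group_center (Dis Q)"
abbreviation left_translation (\<open>\<L>\<close>) where "\<L> a \<equiv> ltrans Q a"

lemma perm_cancel [simp]:
  assumes "g \<in> \<G>" "h \<in> \<G>"
  shows "g \<cdot> (\<iota> g \<cdot> h) = h" "\<iota> g \<cdot> (g \<cdot> h) = h"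
  using assms by (simp_all flip: G.m_assoc)

lemmas perm_simps = G.m_assoc G.inv_mult_group

lemma perm_app_closed [simp]: "g \<in> \<G> \<Longrightarrow> x \<in> carrier Q \<Longrightarrow> g x \<in> carrier Q"
  by (auto simp: BijGroup_def Bij_def bij_betw_def)

lemma perm_mult_app [simp]:
  "g \<in> \<G> \<Longrightarrow> h \<in> \<G> \<Longrightarrow> x \<in> carrier Q \<Longrightarrow> (g \<cdot> h) x = g (h x)"
  by (simp add: BijGroup_def compose_def)

lemma perm_one_app [simp]: "x \<in> carrier Q \<Longrightarrow> \<one>\<^bsub>BijGroup (carrier Q)\<^esub> x = x"
  by (simp add: BijGroup_def)

lemma perm_eqI:
  assumes "g \<in> \<G>" "h \<in> \<G>" "\<And>x. x \<in> carrier Q \<Longrightarrow> g x = h x"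
  shows "g = h"
  using assms by (intro extensionalityI[of g "carrier Q" h]) (auto simp: BijGroup_def Bij_def)

lemma perm_inv_app [simp]:
  assumes "g \<in> \<G>" "x \<in> carrier Q"
  shows "g (\<iota> g x) = x" "\<iota> g (g x) = x"
  using assms perm_mult_app[of g "\<iota> g" x] perm_mult_app[of "\<iota> g" g x] by simp_all

lemma ltrans_app [simp]: "x \<in> carrier Q \<Longrightarrow> \<L> a x = a \<star> x"
  by (simp add: ltrans_def)

declare ltrans_in_BijGroup [simp] star_closed [simp] ldiv_closed [simp]
  ldiv_star [simp] star_ldiv [simp]

lemma inv_ltrans_app [simp]:
  assumes "a \<in> carrier Q" "x \<in> carrier Q"
  shows "\<iota> (\<L> a) x = a \<setminus> x"
proof -
  have "a \<star> \<iota> (\<L> a) x = x"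
    using assms perm_inv_app(1)[of "\<L> a" x] by (simp del: perm_inv_app)
  then show ?thesis
    using assms ldiv_star[of a "\<iota> (\<L> a) x"] by simp
qed

lemma ltrans_quot_perm: "a \<in> carrier Q \<Longrightarrow> b \<in> carrier Q \<Longrightarrow> ltrans_quot Q a b \<in> \<G>"
  by (simp add: ltrans_quot_def)

lemma inv_ltrans_quot:
  "a \<in> carrier Q \<Longrightarrow> b \<in> carrier Q \<Longrightarrow> \<iota> (ltrans_quot Q a b) = ltrans_quot Q b a"
  by (simp add: ltrans_quot_def perm_simps)


section \<open>The displacement group and its center\<close>

lemma Dis_mult [simp]: "g \<otimes>\<^bsub>Dis Q\<^esub> h = g \<cdot> h"
  by (simp add: Dis_def)

lemma disps_subgroup: "subgroup \<D> (BijGroup (carrier Q))"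
  unfolding Dis_def by (rule G.subgroup_subgroup_generated)

lemma disps_closed [simp]:
  shows "d \<in> \<D> \<Longrightarrow> d \<in> \<G>"
    and "d \<in> \<D> \<Longrightarrow> d' \<in> \<D> \<Longrightarrow> d \<cdot> d' \<in> \<D>"
    and "d \<in> \<D> \<Longrightarrow> \<iota> d \<in> \<D>"
    and "\<one>\<^bsub>BijGroup (carrier Q)\<^esub> \<in> \<D>"
  using disps_subgroup
  by (simp_all add: subgroup.mem_carrier subgroup.m_closed subgroup.m_inv_closed subgroup.one_closed)

lemma ltrans_quot_disp: "a \<in> carrier Q \<Longrightarrow> b \<in> carrier Q \<Longrightarrow> ltrans_quot Q a b \<in> \<D>"
  unfolding Dis_def carrier_subgroup_generated
  by (intro generate.incl) (auto simp: ltrans_quot_perm)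

text \<open>The inverse of a generator of the displacement group is again a generator, so inverses need no
  case of their own.\<close>

lemma disp_induct [consumes 1, case_names one quot mult]:
  assumes "d \<in> \<D>"
    and one: "P \<one>\<^bsub>BijGroup (carrier Q)\<^esub>"
    and quot: "\<And>a b. a \<in> carrier Q \<Longrightarrow> b \<in> carrier Q \<Longrightarrow> P (ltrans_quot Q a b)"
    and mult: "\<And>d d'. d \<in> \<D> \<Longrightarrow> d' \<in> \<D> \<Longrightarrow> P d \<Longrightarrow> P d' \<Longrightarrow> P (d \<cdot> d')"
  shows "P d"
proof -
  let ?S = "\<G> \<inter> {ltrans_quot Q a b | a b. a \<in> carrier Q \<and> b \<in> carrier Q}"
  have eq: "\<D> = generate (BijGroup (carrier Q)) ?S"
    by (simp add: Dis_def carrier_subgroup_generated)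
  from assms(1) have "d \<in> generate (BijGroup (carrier Q)) ?S"
    unfolding eq .
  then show ?thesis
  proof (induction rule: generate.induct)
    case (eng h1 h2)
    then show ?case unfolding eq[symmetric] by (intro mult)
  qed (auto simp: inv_ltrans_quot intro: one quot)
qed

lemma cent_iff: "z \<in> \<Z> \<longleftrightarrow> z \<in> \<D> \<and> (\<forall>d\<in>\<D>. z \<cdot> d = d \<cdot> z)"
  by (simp add: group_center_def)

lemma centI: "z \<in> \<D> \<Longrightarrow> (\<And>d. d \<in> \<D> \<Longrightarrow> z \<cdot> d = d \<cdot> z) \<Longrightarrow> z \<in> \<Z>"
  by (simp add: cent_iff)

lemma cent_commute: "z \<in> \<Z> \<Longrightarrow> d \<in> \<D> \<Longrightarrow> z \<cdot> d = d \<cdot> z"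
  by (simp add: cent_iff)

lemma cent_disp: "z \<in> \<Z> \<Longrightarrow> z \<in> \<D>"
  by (simp add: cent_iff)

lemma cent_perm [simp]: "z \<in> \<Z> \<Longrightarrow> z \<in> \<G>"
  by (simp add: cent_iff)

lemma cent_one [simp]: "\<one>\<^bsub>BijGroup (carrier Q)\<^esub> \<in> \<Z>"
  by (simp add: cent_iff)

lemma cent_mult [simp]:
  assumes "z \<in> \<Z>" "w \<in> \<Z>"
  shows "z \<cdot> w \<in> \<Z>"
proof -
  have "z \<cdot> w \<cdot> d = d \<cdot> (z \<cdot> w)" if d: "d \<in> \<D>" for d
  proof -
    have "z \<cdot> w \<cdot> d = z \<cdot> d \<cdot> w"
      using assms d cent_commute[of w d] by (simp add: G.m_assoc)
    also have "\<dots> = d \<cdot> (z \<cdot> w)"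
      using assms d cent_commute[of z d] by (simp add: G.m_assoc)
    finally show ?thesis .
  qed
  then show ?thesis
    using assms by (intro centI) (simp_all add: cent_disp)
qed

lemma cent_inv [simp]:
  assumes "z \<in> \<Z>"
  shows "\<iota> z \<in> \<Z>"
proof -
  have "\<iota> z \<cdot> d = d \<cdot> \<iota> z" if d: "d \<in> \<D>" for d
  proof -
    have "\<iota> z \<cdot> d = \<iota> z \<cdot> (d \<cdot> z) \<cdot> \<iota> z"
      using assms d by (simp add: G.m_assoc)
    also have "\<dots> = d \<cdot> \<iota> z"
      unfolding cent_commute[OF assms d, symmetric] using assms d by (simp add: G.m_assoc)
    finally show ?thesis .
  qed
  then show ?thesis
    using assms by (intro centI) (simp_all add: cent_disp)
qed


section \<open>Pairs in a central congruence\<close>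

lemma term_op_cong: "(\<And>i. i \<in> term_vars t \<Longrightarrow> e i = e' i) \<Longrightarrow> term_op Q t e = term_op Q t e'"
  by (induction t) auto

lemma term_op_closed:
  "(\<And>i. i \<in> term_vars t \<Longrightarrow> e i \<in> carrier Q) \<Longrightarrow> term_op Q t e \<in> carrier Q"
  by (induction t) auto

lemma centralizesD:
  assumes "centralizes Q \<alpha> \<beta> \<delta>" "term_vars t \<subseteq> {0..n}" "(a, b) \<in> \<alpha>"
    and "\<forall>i\<in>{1..n}. (u i, v i) \<in> \<beta>"
    and "(term_op Q t (u(0 := a)), term_op Q t (v(0 := a))) \<in> \<delta>"
  shows "(term_op Q t (u(0 := b)), term_op Q t (v(0 := b))) \<in> \<delta>"
  using assms unfolding centralizes_def by metis

text \<open>A permutation is \<^emph>\<open>contractible\<close> if it has the form \<open>x \<mapsto> t(x, u)\<close> for a term \<open>t\<close> that becomes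
  the identity for another choice \<open>v\<close> of the parameters. For such a permutation, having \<open>a\<close> as a fixed
  point is an equation \<open>t(a, u) = t(a, v)\<close> of the kind that the centrality condition transports
  from \<open>a\<close> to \<open>b\<close>.\<close>

definition contractible :: "('a \<Rightarrow> 'a) \<Rightarrow> bool" where
  "contractible h \<longleftrightarrow> (\<exists>n t u v. term_vars t \<subseteq> {0..n} \<and>
     (\<forall>i\<in>{1..n}. u i \<in> carrier Q \<and> v i \<in> carrier Q) \<and>
     (\<forall>x\<in>carrier Q. term_op Q t (u(0 := x)) = h x \<and> term_op Q t (v(0 := x)) = x))"

lemma contractible_quot_mult:
  assumes c: "c \<in> carrier Q" and d: "d \<in> carrier Q"
    and h: "h \<in> \<G>" "contractible h"
  shows "contractible (ltrans_quot Q c d \<cdot> h)"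
proof -
  from h(2) obtain n t u v where t: "term_vars t \<subseteq> {0..n}"
    and uv: "\<And>i. i \<in> {1..n} \<Longrightarrow> u i \<in> carrier Q \<and> v i \<in> carrier Q"
    and ev: "\<And>x. x \<in> carrier Q \<Longrightarrow> term_op Q t (u(0 := x)) = h x \<and> term_op Q t (v(0 := x)) = x"
    unfolding contractible_def by blast
  \<comment> \<open>Two fresh variables hold \<open>c\<close> and \<open>d\<close>; giving both of them the value \<open>c\<close> cancels the new factor.\<close>
  let ?t = "Star (Var (n + 1)) (Ldiv (Var (n + 2)) t)"
  let ?u = "u(n + 1 := c, n + 2 := d)" and ?v = "v(n + 1 := c, n + 2 := c)"
  have "term_vars ?t \<subseteq> {0..n + 2}"
    using t by auto
  moreover have "\<forall>i\<in>{1..n + 2}. ?u i \<in> carrier Q \<and> ?v i \<in> carrier Q"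
    using uv c d by auto
  moreover have "term_op Q ?t (?u(0 := x)) = (ltrans_quot Q c d \<cdot> h) x
      \<and> term_op Q ?t (?v(0 := x)) = x" if x: "x \<in> carrier Q" for x
  proof -
    have "term_op Q t (?u(0 := x)) = h x" "term_op Q t (?v(0 := x)) = x"
      using ev[OF x] t
        term_op_cong[of t "?u(0 := x)" "u(0 := x)"] term_op_cong[of t "?v(0 := x)" "v(0 := x)"]
      by fastforce+
    then show ?thesis
      using c d h x by (simp add: ltrans_quot_def)
  qed
  ultimately show ?thesis
    unfolding contractible_def by blast
qed

lemma disp_contractible:
  assumes "d \<in> \<D>"
  shows "contractible d"
proof -
  \<comment> \<open>Strengthened to left multiples, so that the product case of the induction is immediate.\<close>
  have step: "h \<in> \<G> \<Longrightarrow> contractible h \<Longrightarrow> contractible (d \<cdot> h)" for h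
    using assms
  proof (induction arbitrary: h rule: disp_induct)
    case (mult d d')
    then show ?case by (simp add: G.m_assoc)
  qed (auto intro: contractible_quot_mult)
  have "contractible \<one>\<^bsub>BijGroup (carrier Q)\<^esub>"
    unfolding contractible_def
    by (intro exI[of _ 0] exI[of _ "Var 0"]) auto
  from step[OF _ this] show ?thesis
    using assms by simp
qed

lemma centralizes_stabilizer:
  assumes central: "centralizes Q \<zeta> (carrier Q \<times> carrier Q) (Id_on (carrier Q))"
    and ab: "(a, b) \<in> \<zeta>" "a \<in> carrier Q" "b \<in> carrier Q"
    and d: "d \<in> \<D>" "d a = a"
  shows "d b = b"
proof -
  from disp_contractible[OF d(1)] obtain n t u v where t: "term_vars t \<subseteq> {0..n}"
    and uv: "\<forall>i\<in>{1..n}. (u i, v i) \<in> carrier Q \<times> carrier Q"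
    and ev: "\<And>x. x \<in> carrier Q \<Longrightarrow> term_op Q t (u(0 := x)) = d x \<and> term_op Q t (v(0 := x)) = x"
    unfolding contractible_def by auto
  have "(term_op Q t (u(0 := a)), term_op Q t (v(0 := a))) \<in> Id_on (carrier Q)"
    using ev d(2) ab(2) by auto
  with centralizesD[OF central t ab(1) uv]
  have "(term_op Q t (u(0 := b)), term_op Q t (v(0 := b))) \<in> Id_on (carrier Q)" .
  then show ?thesis
    using ev ab(3) by auto
qed

text \<open>Commuting of \<open>\<L> a \<cdot> \<iota> (\<L> b)\<close> with \<open>g\<close> means that \<open>g\<close> has the same conjugates under \<open>\<L> a\<close> and
  \<open>\<L> b\<close>, and conjugation by \<open>\<L> x\<close> is a term operation in \<open>x\<close>.\<close>

lemma centralizes_quot_commute: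
  assumes central: "centralizes Q \<zeta> (carrier Q \<times> carrier Q) (Id_on (carrier Q))"
    and ab: "(a, b) \<in> \<zeta>" "a \<in> carrier Q" "b \<in> carrier Q"
    and cd: "c \<in> carrier Q" "d \<in> carrier Q"
  shows "ltrans_quot Q a b \<cdot> ltrans_quot Q c d = ltrans_quot Q c d \<cdot> ltrans_quot Q a b"
proof -
  let ?g = "ltrans_quot Q c d"
  have g: "?g \<in> \<G>"
    using cd by (rule ltrans_quot_perm)
  have "a \<setminus> (c \<star> (d \<setminus> (a \<star> x))) = b \<setminus> (c \<star> (d \<setminus> (b \<star> x)))" if x: "x \<in> carrier Q" for x
  proof -
    let ?t = "Ldiv (Var 0) (Star (Var 1) (Ldiv (Var 2) (Star (Var 0) (Var 3))))"
    \<comment> \<open>The second parameter tuple makes the conjugated permutation trivial, and its last entry is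
      the value at \<open>a\<close>. So the two tuples give equal values at \<open>a\<close>.\<close>
    define y where "y = a \<setminus> (c \<star> (d \<setminus> (a \<star> x)))"
    define u where "u = (\<lambda>i::nat. if i = 1 then c else if i = 2 then d else x)"
    define v where "v = (\<lambda>i::nat. if i = 1 then c else if i = 2 then c else y)"
    have y: "y \<in> carrier Q"
      using ab cd x by (simp add: y_def)
    have "term_vars ?t \<subseteq> {0..3}"
      by auto
    moreover have "\<forall>i\<in>{1..3}. (u i, v i) \<in> carrier Q \<times> carrier Q"
      using cd x y by (simp add: u_def v_def)
    moreover have "(term_op Q ?t (u(0 := a)), term_op Q ?t (v(0 := a))) \<in> Id_on (carrier Q)"
      using ab cd x y by (simp add: u_def v_def y_def Id_on_iff)
    ultimately have "(term_op Q ?t (u(0 := b)), term_op Q ?t (v(0 := b))) \<in> Id_on (carrier Q)"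
      by (rule centralizesD[OF central _ ab(1)])
    then have "b \<setminus> (c \<star> (d \<setminus> (b \<star> x))) = y"
      using ab cd x y by (auto simp: u_def v_def)
    then show ?thesis
      by (simp add: y_def)
  qed
  then have conj: "\<iota> (\<L> a) \<cdot> ?g \<cdot> \<L> a = \<iota> (\<L> b) \<cdot> ?g \<cdot> \<L> b"
    using ab cd by (intro perm_eqI) (simp_all add: ltrans_quot_def)
  have "?g \<cdot> (\<L> a \<cdot> \<iota> (\<L> b)) = \<L> a \<cdot> (\<iota> (\<L> a) \<cdot> ?g \<cdot> \<L> a) \<cdot> \<iota> (\<L> b)"
    using ab g by (simp add: perm_simps)
  also have "\<dots> = \<L> a \<cdot> \<iota> (\<L> b) \<cdot> ?g"
    unfolding conj using ab g by (simp add: perm_simps)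
  finally show ?thesis
    by (simp add: ltrans_quot_def[of Q a b])
qed

lemma centralizes_quot_cent:
  assumes central: "centralizes Q \<zeta> (carrier Q \<times> carrier Q) (Id_on (carrier Q))"
    and ab: "(a, b) \<in> \<zeta>" "a \<in> carrier Q" "b \<in> carrier Q"
  shows "ltrans_quot Q a b \<in> \<Z>"
proof -
  let ?w = "ltrans_quot Q a b"
  have w: "?w \<in> \<D>"
    using ab by (intro ltrans_quot_disp)
  have "?w \<cdot> d = d \<cdot> ?w" if "d \<in> \<D>" for d
    using that
  proof (induction rule: disp_induct)
    case (quot c d)
    then show ?case by (intro centralizes_quot_commute[OF central ab])
  next
    case (mult d d')
    have "?w \<cdot> (d \<cdot> d') = ?w \<cdot> d \<cdot> d'"
      using w mult.hyps by (simp add: G.m_assoc)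
    also have "\<dots> = d \<cdot> (?w \<cdot> d')"
      using w mult.hyps by (simp add: mult.IH(1) G.m_assoc)
    also have "\<dots> = d \<cdot> d' \<cdot> ?w"
      using w mult.hyps by (simp add: mult.IH(2) G.m_assoc)
    finally show ?case .
  qed (use w in simp)
  then show ?thesis
    using w by (intro centI)
qed

lemma sigma_rel_iff:
  "(a, b) \<in> sigma_rel Q \<longleftrightarrow> a \<in> carrier Q \<and> b \<in> carrier Q \<and> (\<forall>d\<in>\<D>. d a = a \<longleftrightarrow> d b = b)"
  by (auto simp: sigma_rel_def stabilizer_def)

lemma con_rel_iff:
  "(a, b) \<in> con_rel Q N \<longleftrightarrow> a \<in> carrier Q \<and> b \<in> carrier Q \<and> ltrans_quot Q a b \<in> N"
  by (auto simp: con_rel_def)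

proposition central_congruence_subset:
  assumes "congruence Q \<zeta>"
    and central: "centralizes Q \<zeta> (carrier Q \<times> carrier Q) (Id_on (carrier Q))"
  shows "\<zeta> \<subseteq> con_rel Q \<Z> \<inter> sigma_rel Q"
proof (intro subsetI IntI; clarify)
  from assms(1) have eqv: "equiv (carrier Q) \<zeta>"
    by (simp add: congruence_def)
  fix a b assume ab: "(a, b) \<in> \<zeta>"
  then have Q: "a \<in> carrier Q" "b \<in> carrier Q"
    using equiv_type[OF eqv] by auto
  have ba: "(b, a) \<in> \<zeta>"
    using ab eqv by (auto simp: equiv_def dest: symD)
  show "(a, b) \<in> con_rel Q \<Z>"
    using Q centralizes_quot_cent[OF central ab Q] by (simp add: con_rel_iff)
  show "(a, b) \<in> sigma_rel Q"
    using Q centralizes_stabilizer[OF central ab Q] centralizes_stabilizer[OF central ba Q(2,1)]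
    by (auto simp: sigma_rel_iff)
qed

lemma equiv_con_cent_sigma: "equiv (carrier Q) (con_rel Q \<Z> \<inter> sigma_rel Q)"
proof (rule equivI)
  show "con_rel Q \<Z> \<inter> sigma_rel Q \<subseteq> carrier Q \<times> carrier Q"
    by (auto simp: con_rel_def)
  show "refl_on (carrier Q) (con_rel Q \<Z> \<inter> sigma_rel Q)"
    by (auto simp: refl_on_def con_rel_iff sigma_rel_iff ltrans_quot_def)
  show "sym (con_rel Q \<Z> \<inter> sigma_rel Q)"
  proof (rule symI)
    fix a b assume ab: "(a, b) \<in> con_rel Q \<Z> \<inter> sigma_rel Q"
    then have "ltrans_quot Q b a \<in> \<Z>"
      using cent_inv[of "ltrans_quot Q a b"] by (simp add: con_rel_iff inv_ltrans_quot)
    then show "(b, a) \<in> con_rel Q \<Z> \<inter> sigma_rel Q"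
      using ab by (simp add: con_rel_iff sigma_rel_iff)
  qed
  show "trans (con_rel Q \<Z> \<inter> sigma_rel Q)"
  proof (rule transI)
    fix a b c assume "(a, b) \<in> con_rel Q \<Z> \<inter> sigma_rel Q" "(b, c) \<in> con_rel Q \<Z> \<inter> sigma_rel Q"
    moreover from this have "ltrans_quot Q a c = ltrans_quot Q a b \<cdot> ltrans_quot Q b c"
      by (simp add: con_rel_iff ltrans_quot_def perm_simps)
    ultimately show "(a, c) \<in> con_rel Q \<Z> \<inter> sigma_rel Q"
      by (auto simp: con_rel_iff sigma_rel_iff)
  qed
qed

end


section \<open>Conjugation by translations in a rack\<close>

context rack
begin

lemma ltrans_star:
  assumes "a \<in> carrier Q" "b \<in> carrier Q"
  shows "\<L> (a \<star> b) = \<L> a \<cdot> \<L> b \<cdot> \<iota> (\<L> a)"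
  using assms left_distrib[of a b "a \<setminus> x" for x]
  by (intro perm_eqI) simp_all

lemma ltrans_ldiv:
  assumes "a \<in> carrier Q" "b \<in> carrier Q"
  shows "\<L> (a \<setminus> b) = \<iota> (\<L> a) \<cdot> \<L> b \<cdot> \<L> a"
  using assms ltrans_star[of a "a \<setminus> b"] by (simp add: perm_simps)

lemma disp_conj:
  assumes p: "p \<in> carrier Q" and "d \<in> \<D>"
  shows "\<L> p \<cdot> d \<cdot> \<iota> (\<L> p) \<in> \<D>" "\<iota> (\<L> p) \<cdot> d \<cdot> \<L> p \<in> \<D>"
proof -
  have "\<L> p \<cdot> d \<cdot> \<iota> (\<L> p) \<in> \<D> \<and> \<iota> (\<L> p) \<cdot> d \<cdot> \<L> p \<in> \<D>"
    using assms(2)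
  proof (induction rule: disp_induct)
    case (quot a b)
    have "\<L> p \<cdot> ltrans_quot Q a b \<cdot> \<iota> (\<L> p) = ltrans_quot Q (p \<star> a) (p \<star> b)"
      "\<iota> (\<L> p) \<cdot> ltrans_quot Q a b \<cdot> \<L> p = ltrans_quot Q (p \<setminus> a) (p \<setminus> b)"
      using p quot by (simp_all add: ltrans_quot_def ltrans_star ltrans_ldiv perm_simps)
    then show ?case
      using p quot by (simp add: ltrans_quot_disp)
  next
    case (mult d d')
    have "\<L> p \<cdot> (d \<cdot> d') \<cdot> \<iota> (\<L> p) = (\<L> p \<cdot> d \<cdot> \<iota> (\<L> p)) \<cdot> (\<L> p \<cdot> d' \<cdot> \<iota> (\<L> p))"
      "\<iota> (\<L> p) \<cdot> (d \<cdot> d') \<cdot> \<L> p = (\<iota> (\<L> p) \<cdot> d \<cdot> \<L> p) \<cdot> (\<iota> (\<L> p) \<cdot> d' \<cdot> \<L> p)"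
      using p mult.hyps by (simp_all add: perm_simps)
    then show ?case
      using mult.IH by simp
  qed (use p in simp)
  then show "\<L> p \<cdot> d \<cdot> \<iota> (\<L> p) \<in> \<D>" "\<iota> (\<L> p) \<cdot> d \<cdot> \<L> p \<in> \<D>"
    by blast+
qed

text \<open>Conjugation by different translations on the two sides: the exponents of the
  translations still add up to zero.\<close>

lemma disp_conj_quot:
  assumes "p \<in> carrier Q" "q \<in> carrier Q" "d \<in> \<D>"
  shows "\<L> p \<cdot> d \<cdot> \<iota> (\<L> q) \<in> \<D>" "\<iota> (\<L> p) \<cdot> d \<cdot> \<L> q \<in> \<D>"
proof -
  have "\<L> p \<cdot> d \<cdot> \<iota> (\<L> q) = (\<L> p \<cdot> d \<cdot> \<iota> (\<L> p)) \<cdot> ltrans_quot Q p q"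
    "\<iota> (\<L> p) \<cdot> d \<cdot> \<L> q = \<iota> (\<L> p) \<cdot> (d \<cdot> ltrans_quot Q q p) \<cdot> \<L> p"
    using assms by (simp_all add: ltrans_quot_def perm_simps)
  then show "\<L> p \<cdot> d \<cdot> \<iota> (\<L> q) \<in> \<D>" "\<iota> (\<L> p) \<cdot> d \<cdot> \<L> q \<in> \<D>"
    using assms by (simp_all add: disp_conj ltrans_quot_disp)
qed

lemma cent_conj:
  assumes "p \<in> carrier Q" "z \<in> \<Z>"
  shows "\<L> p \<cdot> z \<cdot> \<iota> (\<L> p) \<in> \<Z>" "\<iota> (\<L> p) \<cdot> z \<cdot> \<L> p \<in> \<Z>"
proof -
  have "\<L> p \<cdot> z \<cdot> \<iota> (\<L> p) \<cdot> d = d \<cdot> (\<L> p \<cdot> z \<cdot> \<iota> (\<L> p))" if d: "d \<in> \<D>" for d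
  proof -
    have "\<L> p \<cdot> z \<cdot> \<iota> (\<L> p) \<cdot> d = \<L> p \<cdot> (z \<cdot> (\<iota> (\<L> p) \<cdot> d \<cdot> \<L> p)) \<cdot> \<iota> (\<L> p)"
      using assms d by (simp add: perm_simps)
    also have "\<dots> = d \<cdot> (\<L> p \<cdot> z \<cdot> \<iota> (\<L> p))"
      unfolding cent_commute[OF assms(2) disp_conj(2)[OF assms(1) d]] using assms d by (simp add: perm_simps)
    finally show ?thesis .
  qed
  then show "\<L> p \<cdot> z \<cdot> \<iota> (\<L> p) \<in> \<Z>"
    using assms by (intro centI) (simp_all add: disp_conj cent_disp)
  have "\<iota> (\<L> p) \<cdot> z \<cdot> \<L> p \<cdot> d = d \<cdot> (\<iota> (\<L> p) \<cdot> z \<cdot> \<L> p)" if d: "d \<in> \<D>" for d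
  proof -
    have "\<iota> (\<L> p) \<cdot> z \<cdot> \<L> p \<cdot> d = \<iota> (\<L> p) \<cdot> (z \<cdot> (\<L> p \<cdot> d \<cdot> \<iota> (\<L> p))) \<cdot> \<L> p"
      using assms d by (simp add: perm_simps)
    also have "\<dots> = d \<cdot> (\<iota> (\<L> p) \<cdot> z \<cdot> \<L> p)"
      unfolding cent_commute[OF assms(2) disp_conj(1)[OF assms(1) d]] using assms d by (simp add: perm_simps)
    finally show ?thesis .
  qed
  then show "\<iota> (\<L> p) \<cdot> z \<cdot> \<L> p \<in> \<Z>"
    using assms by (intro centI) (simp_all add: disp_conj cent_disp)
qed

text \<open>Two translations differ by a displacement, which commutes with \<open>z\<close>. So all translations induce
  the same automorphism of the center.\<close>

lemma cent_conj_indep: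
  assumes "p \<in> carrier Q" "q \<in> carrier Q" "z \<in> \<Z>"
  shows "\<L> p \<cdot> z \<cdot> \<iota> (\<L> p) = \<L> q \<cdot> z \<cdot> \<iota> (\<L> q)" "\<iota> (\<L> p) \<cdot> z \<cdot> \<L> p = \<iota> (\<L> q) \<cdot> z \<cdot> \<L> q"
proof -
  have 1: "\<iota> (\<L> q) \<cdot> \<L> p \<in> \<D>" and 2: "\<L> q \<cdot> \<iota> (\<L> p) \<in> \<D>"
    using assms disp_conj_quot[of q p "\<one>\<^bsub>BijGroup (carrier Q)\<^esub>"] by simp_all
  have "\<L> p \<cdot> z \<cdot> \<iota> (\<L> p) = \<L> q \<cdot> (\<iota> (\<L> q) \<cdot> \<L> p \<cdot> z) \<cdot> \<iota> (\<L> p)"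
    using assms by (simp add: perm_simps)
  also have "\<dots> = \<L> q \<cdot> z \<cdot> \<iota> (\<L> q)"
    unfolding cent_commute[OF assms(3) 1, symmetric] using assms by (simp add: perm_simps)
  finally show "\<L> p \<cdot> z \<cdot> \<iota> (\<L> p) = \<L> q \<cdot> z \<cdot> \<iota> (\<L> q)" .
  have "\<iota> (\<L> p) \<cdot> z \<cdot> \<L> p = \<iota> (\<L> q) \<cdot> (\<L> q \<cdot> \<iota> (\<L> p) \<cdot> z) \<cdot> \<L> p"
    using assms by (simp add: perm_simps)
  also have "\<dots> = \<iota> (\<L> q) \<cdot> z \<cdot> \<L> q"
    unfolding cent_commute[OF assms(3) 2, symmetric] using assms by (simp add: perm_simps)
  finally show "\<iota> (\<L> p) \<cdot> z \<cdot> \<L> p = \<iota> (\<L> q) \<cdot> z \<cdot> \<L> q" .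
qed


section \<open>Replacing an argument of a term by a related one\<close>

text \<open>The factor \<open>z\<close> is found before the parameters \<open>e\<close> are chosen; this uniformity is what later allows
  the factors of two different parameter tuples to cancel. In the induction step \<open>\<L> (s \<star> t)\<close> is the
  conjugate of \<open>\<L> t\<close> by \<open>\<L> s\<close>. Collecting the central factors on the left conjugates them by
  translations that depend on \<open>e\<close>, but all translations give the same conjugates.\<close>

lemma term_ltrans_factor:
  assumes Q: "a \<in> carrier Q" "b \<in> carrier Q" and cent: "ltrans_quot Q b a \<in> \<Z>"
  shows "\<exists>z\<in>\<Z>. \<forall>e. (\<forall>i\<in>term_vars t - {0}. e i \<in> carrier Q) \<longrightarrow>
    \<L> (term_op Q t (e(0 := b))) = z \<cdot> \<L> (term_op Q t (e(0 := a)))"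
proof (induction t)
  case (Var i)
  show ?case
  proof (cases "i = 0")
    case True
    have "\<L> b = ltrans_quot Q b a \<cdot> \<L> a"
      using Q by (simp add: ltrans_quot_def perm_simps)
    then show ?thesis
      using True cent by auto
  next
    case False
    then show ?thesis
      by (intro bexI[of _ "\<one>\<^bsub>BijGroup (carrier Q)\<^esub>"]) auto
  qed
next
  case (Star s t)
  from Star obtain z y where z: "z \<in> \<Z>" and y: "y \<in> \<Z>"
    and zs: "\<And>e. (\<forall>i\<in>term_vars s - {0}. e i \<in> carrier Q) \<Longrightarrow>
        \<L> (term_op Q s (e(0 := b))) = z \<cdot> \<L> (term_op Q s (e(0 := a)))"
    and yt: "\<And>e. (\<forall>i\<in>term_vars t - {0}. e i \<in> carrier Q) \<Longrightarrow>
        \<L> (term_op Q t (e(0 := b))) = y \<cdot> \<L> (term_op Q t (e(0 := a)))"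
    by blast
  \<comment> \<open>From \<open>z \<L>\<^sub>s y \<L>\<^sub>t (z \<L>\<^sub>s)\<^sup>-\<^sup>1\<close>: moving \<open>y\<close> to the left past \<open>\<L>\<^sub>s\<close> and the inverse of \<open>z\<close> past the
    conjugate of \<open>\<L>\<^sub>t\<close> yields the last two factors, with \<open>a\<close> as a fixed representative.\<close>
  let ?w = "z \<cdot> (\<L> a \<cdot> y \<cdot> \<iota> (\<L> a)) \<cdot> (\<L> a \<cdot> \<iota> z \<cdot> \<iota> (\<L> a))"
  have "\<L> (term_op Q (Star s t) (e(0 := b))) = ?w \<cdot> \<L> (term_op Q (Star s t) (e(0 := a)))"
    if e: "\<forall>i\<in>term_vars (Star s t) - {0}. e i \<in> carrier Q" for e
  proof -
    define p p' q q' where "p = term_op Q s (e(0 := a))" and "p' = term_op Q s (e(0 := b))"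
      and "q = term_op Q t (e(0 := a))" and "q' = term_op Q t (e(0 := b))"
    have pq: "p \<in> carrier Q" "p' \<in> carrier Q" "q \<in> carrier Q" "q' \<in> carrier Q"
      using e Q unfolding p_def p'_def q_def q'_def by (auto intro!: term_op_closed)
    have p': "\<L> p' = z \<cdot> \<L> p" and q': "\<L> q' = y \<cdot> \<L> q"
      using e zs yt unfolding p_def p'_def q_def q'_def by auto
    have "\<L> (p' \<star> q') = z \<cdot> (\<L> p \<cdot> y \<cdot> \<iota> (\<L> p)) \<cdot> (\<L> (p \<star> q) \<cdot> \<iota> z \<cdot> \<iota> (\<L> (p \<star> q))) \<cdot> \<L> (p \<star> q)"
      using pq z y by (simp add: ltrans_star p' q' perm_simps)
    also have "\<dots> = ?w \<cdot> \<L> (p \<star> q)"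
      using pq Q z y cent_conj_indep(1)[of p a y] cent_conj_indep(1)[of "p \<star> q" a "\<iota> z"] by simp
    finally show ?thesis
      by (simp add: p_def p'_def q_def q'_def)
  qed
  moreover have "?w \<in> \<Z>"
    using Q z y by (simp add: cent_conj)
  ultimately show ?case
    by blast
next
  case (Ldiv s t)
  from Ldiv obtain z y where z: "z \<in> \<Z>" and y: "y \<in> \<Z>"
    and zs: "\<And>e. (\<forall>i\<in>term_vars s - {0}. e i \<in> carrier Q) \<Longrightarrow>
        \<L> (term_op Q s (e(0 := b))) = z \<cdot> \<L> (term_op Q s (e(0 := a)))"
    and yt: "\<And>e. (\<forall>i\<in>term_vars t - {0}. e i \<in> carrier Q) \<Longrightarrow>
        \<L> (term_op Q t (e(0 := b))) = y \<cdot> \<L> (term_op Q t (e(0 := a)))"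
    by blast
  \<comment> \<open>From \<open>(z \<L>\<^sub>s)\<^sup>-\<^sup>1 y \<L>\<^sub>t z \<L>\<^sub>s\<close>: the central factors that gather between \<open>\<L>\<^sub>s\<^sup>-\<^sup>1\<close> and \<open>\<L>\<^sub>t\<close>.\<close>
  let ?x = "\<iota> z \<cdot> y \<cdot> (\<L> a \<cdot> z \<cdot> \<iota> (\<L> a))"
  let ?w = "\<iota> (\<L> a) \<cdot> ?x \<cdot> \<L> a"
  have x: "?x \<in> \<Z>"
    using Q z y by (simp add: cent_conj)
  have "\<L> (term_op Q (Ldiv s t) (e(0 := b))) = ?w \<cdot> \<L> (term_op Q (Ldiv s t) (e(0 := a)))"
    if e: "\<forall>i\<in>term_vars (Ldiv s t) - {0}. e i \<in> carrier Q" for e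
  proof -
    define p p' q q' where "p = term_op Q s (e(0 := a))" and "p' = term_op Q s (e(0 := b))"
      and "q = term_op Q t (e(0 := a))" and "q' = term_op Q t (e(0 := b))"
    have pq: "p \<in> carrier Q" "p' \<in> carrier Q" "q \<in> carrier Q" "q' \<in> carrier Q"
      using e Q unfolding p_def p'_def q_def q'_def by (auto intro!: term_op_closed)
    have p': "\<L> p' = z \<cdot> \<L> p" and q': "\<L> q' = y \<cdot> \<L> q"
      using e zs yt unfolding p_def p'_def q_def q'_def by auto
    have "\<L> (p' \<setminus> q') = \<iota> (\<L> p) \<cdot> (\<iota> z \<cdot> y \<cdot> (\<L> q \<cdot> z \<cdot> \<iota> (\<L> q))) \<cdot> \<L> p \<cdot> \<L> (p \<setminus> q)"
      using pq z y by (simp add: ltrans_ldiv p' q' perm_simps)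
    also have "\<dots> = \<iota> (\<L> p) \<cdot> ?x \<cdot> \<L> p \<cdot> \<L> (p \<setminus> q)"
      using pq Q z cent_conj_indep(1)[of q a z] by simp
    also have "\<dots> = ?w \<cdot> \<L> (p \<setminus> q)"
      using cent_conj_indep(2)[OF pq(1) Q(1) x] by simp
    finally show ?thesis
      by (simp add: p_def p'_def q_def q'_def)
  qed
  moreover have "?w \<in> \<Z>"
    using Q x by (simp add: cent_conj)
  ultimately show ?case
    by blast
qed

text \<open>The displacement \<open>d\<close> is there for the sake of the induction: to pass from \<open>s \<star> t\<close> to \<open>t\<close>, the
  translations by the two values of \<open>s\<close> are absorbed into \<open>d\<close>, and the result is again a displacement.
  When \<open>a\<close> is replaced by \<open>b\<close>, both translations gain the same central factor, and these factors
  cancel because \<open>d\<close> commutes with them. The stabilizer hypothesis is the case of the variable that is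
  being replaced.\<close>

lemma term_disp_transfer:
  assumes Q: "a \<in> carrier Q" "b \<in> carrier Q" and cent: "ltrans_quot Q b a \<in> \<Z>"
    and stab: "\<forall>d\<in>\<D>. d a = a \<longrightarrow> d b = b"
    and "d \<in> \<D>"
    and "\<forall>i\<in>term_vars t - {0}. u i \<in> carrier Q" "\<forall>i\<in>term_vars t - {0}. v i \<in> carrier Q"
    and "d (term_op Q t (u(0 := a))) = term_op Q t (v(0 := a))"
  shows "d (term_op Q t (u(0 := b))) = term_op Q t (v(0 := b))"
  using assms(5-)
proof (induction t arbitrary: d)
  case (Var i)
  then show ?case using stab by (cases "i = 0") auto
next
  case (Star s t)
  obtain z where z: "z \<in> \<Z>"
    and zs: "\<And>e. (\<forall>i\<in>term_vars s - {0}. e i \<in> carrier Q) \<Longrightarrow>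
        \<L> (term_op Q s (e(0 := b))) = z \<cdot> \<L> (term_op Q s (e(0 := a)))"
    using term_ltrans_factor[OF Q cent, of s] by blast
  define p p' r r' where "p = term_op Q s (u(0 := a))" and "p' = term_op Q s (u(0 := b))"
    and "r = term_op Q s (v(0 := a))" and "r' = term_op Q s (v(0 := b))"
  define q q' w w' where "q = term_op Q t (u(0 := a))" and "q' = term_op Q t (u(0 := b))"
    and "w = term_op Q t (v(0 := a))" and "w' = term_op Q t (v(0 := b))"
  note defs = p_def p'_def r_def r'_def q_def q'_def w_def w'_def
  have pq: "p \<in> carrier Q" "p' \<in> carrier Q" "q \<in> carrier Q" "q' \<in> carrier Q"
    "r \<in> carrier Q" "r' \<in> carrier Q" "w \<in> carrier Q" "w' \<in> carrier Q"
    using Star.prems Q unfolding defs by (auto intro!: term_op_closed)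
  have p': "\<L> p' = z \<cdot> \<L> p" and r': "\<L> r' = z \<cdot> \<L> r"
    using Star.prems zs unfolding defs by auto
  let ?d = "\<iota> (\<L> r) \<cdot> d \<cdot> \<L> p"
  have d: "?d \<in> \<D>"
    using pq Star.prems by (intro disp_conj_quot)
  have "d (p \<star> q) = r \<star> w"
    using Star.prems(4) unfolding defs term_op.simps .
  then have "?d q = w"
    using pq Star.prems by simp
  moreover have "?d q = w \<Longrightarrow> ?d q' = w'"
    unfolding q_def q'_def w_def w'_def
    by (rule Star.IH(2)[OF d]) (use Star.prems(2,3) in \<open>simp_all add: fun_upd_def\<close>)
  ultimately have w': "?d q' = w'"
    by blast
  have "d (p' \<star> q') = (d \<cdot> \<L> p') q'"
    using pq Star.prems by simp
  also have "d \<cdot> \<L> p' = d \<cdot> z \<cdot> \<L> p"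
    using pq z Star.prems by (simp add: p' G.m_assoc)
  also have "\<dots> = z \<cdot> d \<cdot> \<L> p"
    using z Star.prems by (simp add: cent_commute)
  also have "\<dots> = \<L> r' \<cdot> ?d"
    using pq z Star.prems by (simp add: r' perm_simps)
  also have "(\<L> r' \<cdot> ?d) q' = r' \<star> w'"
    using pq d Star.prems(1) w' perm_mult_app[of "\<L> r'" ?d q'] by simp
  finally show ?case
    by (simp add: defs fun_upd_def)
next
  case (Ldiv s t)
  obtain z where z: "z \<in> \<Z>"
    and zs: "\<And>e. (\<forall>i\<in>term_vars s - {0}. e i \<in> carrier Q) \<Longrightarrow>
        \<L> (term_op Q s (e(0 := b))) = z \<cdot> \<L> (term_op Q s (e(0 := a)))"
    using term_ltrans_factor[OF Q cent, of s] by blast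
  define p p' r r' where "p = term_op Q s (u(0 := a))" and "p' = term_op Q s (u(0 := b))"
    and "r = term_op Q s (v(0 := a))" and "r' = term_op Q s (v(0 := b))"
  define q q' w w' where "q = term_op Q t (u(0 := a))" and "q' = term_op Q t (u(0 := b))"
    and "w = term_op Q t (v(0 := a))" and "w' = term_op Q t (v(0 := b))"
  note defs = p_def p'_def r_def r'_def q_def q'_def w_def w'_def
  have pq: "p \<in> carrier Q" "p' \<in> carrier Q" "q \<in> carrier Q" "q' \<in> carrier Q"
    "r \<in> carrier Q" "r' \<in> carrier Q" "w \<in> carrier Q" "w' \<in> carrier Q"
    using Ldiv.prems Q unfolding defs by (auto intro!: term_op_closed)
  have p': "\<L> p' = z \<cdot> \<L> p" and r': "\<L> r' = z \<cdot> \<L> r"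
    using Ldiv.prems zs unfolding defs by auto
  let ?d = "\<L> r \<cdot> d \<cdot> \<iota> (\<L> p)"
  have d: "?d \<in> \<D>"
    using pq Ldiv.prems by (intro disp_conj_quot)
  have "d (p \<setminus> q) = r \<setminus> w"
    using Ldiv.prems(4) unfolding defs term_op.simps .
  then have "?d q = w"
    using pq Ldiv.prems by simp
  moreover have "?d q = w \<Longrightarrow> ?d q' = w'"
    unfolding q_def q'_def w_def w'_def
    by (rule Ldiv.IH(2)[OF d]) (use Ldiv.prems(2,3) in \<open>simp_all add: fun_upd_def\<close>)
  ultimately have w': "?d q' = w'"
    by blast
  have "d (p' \<setminus> q') = (d \<cdot> \<iota> (\<L> p')) q'"
    using pq Ldiv.prems by simp
  also have "d \<cdot> \<iota> (\<L> p') = \<iota> (\<L> r) \<cdot> (?d \<cdot> \<iota> z)"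
    using pq z Ldiv.prems by (simp add: p' perm_simps)
  also have "\<dots> = \<iota> (\<L> r) \<cdot> (\<iota> z \<cdot> ?d)"
    using z d by (simp only: cent_commute[OF cent_inv])
  also have "\<dots> = \<iota> (\<L> r') \<cdot> ?d"
    using pq z Ldiv.prems by (simp add: r' perm_simps)
  also have "(\<iota> (\<L> r') \<cdot> ?d) q' = r' \<setminus> w'"
    using pq d Ldiv.prems(1) w' perm_mult_app[of "\<iota> (\<L> r')" ?d q'] by simp
  finally show ?case
    by (simp add: defs fun_upd_def)
qed


section \<open>The intersection is a central congruence\<close>

lemma con_cent_sigmaD:
  assumes "(a, b) \<in> con_rel Q \<Z> \<inter> sigma_rel Q"
  shows "a \<in> carrier Q" "b \<in> carrier Q" "ltrans_quot Q b a \<in> \<Z>"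
    and "\<forall>d\<in>\<D>. d a = a \<longrightarrow> d b = b"
  using assms cent_inv[of "ltrans_quot Q a b"]
  by (auto simp: con_rel_iff sigma_rel_iff inv_ltrans_quot)

lemma centralizes_con_cent_sigma:
  "centralizes Q (con_rel Q \<Z> \<inter> sigma_rel Q) (carrier Q \<times> carrier Q) (Id_on (carrier Q))"
  unfolding centralizes_def
proof (intro allI impI)
  fix n t a b u v
  assume t: "term_vars t \<subseteq> {0..n}" and ab: "(a, b) \<in> con_rel Q \<Z> \<inter> sigma_rel Q"
    and uv: "\<forall>i\<in>{1..n}. (u i, v i) \<in> carrier Q \<times> carrier Q"
    and "(term_op Q t (u(0 := a)), term_op Q t (v(0 := a))) \<in> Id_on (carrier Q)"
  then have eq: "\<one>\<^bsub>BijGroup (carrier Q)\<^esub> (term_op Q t (u(0 := a))) = term_op Q t (v(0 := a))"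
    by auto
  note ab = con_cent_sigmaD[OF ab]
  have "term_vars t - {0} \<subseteq> {1..n}"
    using t by fastforce
  with uv have uv: "\<forall>i\<in>term_vars t - {0}. u i \<in> carrier Q" "\<forall>i\<in>term_vars t - {0}. v i \<in> carrier Q"
    by auto
  have "term_op Q t (u(0 := b)) \<in> carrier Q"
    using ab uv by (intro term_op_closed) auto
  moreover from this
  have "term_op Q t (u(0 := b)) = term_op Q t (v(0 := b))"
    using term_disp_transfer[OF ab disps_closed(4) uv eq] ab t uv
    by (simp add: term_op_closed)
  ultimately show "(term_op Q t (u(0 := b)), term_op Q t (v(0 := b))) \<in> Id_on (carrier Q)"
    by (simp add: Id_on_iff)
qed

text \<open>Taking the same parameters on both sides of the transfer shows that a displacement fixing
  \<open>t(a, e)\<close> fixes \<open>t(b, e)\<close>, and the symmetry of the relation gives the converse.\<close>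

lemma con_cent_sigma_term:
  assumes ab: "(a, b) \<in> con_rel Q \<Z> \<inter> sigma_rel Q"
    and e: "\<forall>i\<in>term_vars t - {0}. e i \<in> carrier Q"
  shows "(term_op Q t (e(0 := a)), term_op Q t (e(0 := b))) \<in> con_rel Q \<Z> \<inter> sigma_rel Q"
proof -
  have ba: "(b, a) \<in> con_rel Q \<Z> \<inter> sigma_rel Q"
    using ab equiv_con_cent_sigma by (auto simp: equiv_def dest: symD)
  note ab = con_cent_sigmaD[OF ab] and ba = con_cent_sigmaD[OF ba]
  let ?p = "term_op Q t (e(0 := a))" and ?q = "term_op Q t (e(0 := b))"
  have p: "?p \<in> carrier Q" and q: "?q \<in> carrier Q"
    using ab e by (auto intro!: term_op_closed)
  obtain z where z: "z \<in> \<Z>" and "\<L> ?p = z \<cdot> \<L> ?q"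
    using term_ltrans_factor[OF ba(1-3), of t] e by blast
  then have "ltrans_quot Q ?p ?q = z"
    using p q by (simp add: ltrans_quot_def perm_simps)
  then have "(?p, ?q) \<in> con_rel Q \<Z>"
    using p q z by (simp add: con_rel_iff)
  moreover have "d ?p = ?p \<longleftrightarrow> d ?q = ?q" if "d \<in> \<D>" for d
    using term_disp_transfer[OF ab that e e] term_disp_transfer[OF ba that e e] by blast
  then have "(?p, ?q) \<in> sigma_rel Q"
    using p q by (simp add: sigma_rel_iff)
  ultimately show ?thesis
    by blast
qed

lemma congruence_con_cent_sigma: "congruence Q (con_rel Q \<Z> \<inter> sigma_rel Q)"
  unfolding congruence_def
proof (intro conjI allI impI)
  let ?r = "con_rel Q \<Z> \<inter> sigma_rel Q"
  show "equiv (carrier Q) ?r"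
    by (rule equiv_con_cent_sigma)
  then have trans: "(x, y) \<in> ?r \<Longrightarrow> (y, z) \<in> ?r \<Longrightarrow> (x, z) \<in> ?r" for x y z
    by (auto simp: equiv_def dest: transD)
  \<comment> \<open>The two arguments of an operation are replaced one after the other.\<close>
  fix a b c d assume ab: "(a, b) \<in> ?r" and cd: "(c, d) \<in> ?r"
  note Q = con_cent_sigmaD(1,2)[OF ab] con_cent_sigmaD(1,2)[OF cd]
  have "(a \<star> c, b \<star> c) \<in> ?r"
    using con_cent_sigma_term[OF ab, of "Star (Var 0) (Var 1)" "\<lambda>_. c"] Q by simp
  moreover have "(b \<star> c, b \<star> d) \<in> ?r"
    using con_cent_sigma_term[OF cd, of "Star (Var 1) (Var 0)" "\<lambda>_. b"] Q by simp
  ultimately show "(a \<star> c, b \<star> d) \<in> ?r"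
    by (rule trans)
  have "(a \<setminus> c, b \<setminus> c) \<in> ?r"
    using con_cent_sigma_term[OF ab, of "Ldiv (Var 0) (Var 1)" "\<lambda>_. c"] Q by simp
  moreover have "(b \<setminus> c, b \<setminus> d) \<in> ?r"
    using con_cent_sigma_term[OF cd, of "Ldiv (Var 1) (Var 0)" "\<lambda>_. b"] Q by simp
  ultimately show "(a \<setminus> c, b \<setminus> d) \<in> ?r"
    by (rule trans)
qed

end

theorem proposition5p9:
  fixes Q :: "('a, 'm) lq_scheme"
  assumes "rack Q"
  shows "center Q = con_rel Q (group_center (Dis Q)) \<inter> sigma_rel Q"
proof -
  interpret rack Q by (fact assms)
  show ?thesis
    unfolding center_def
    by (rule Greatest_equality)
      (use congruence_con_cent_sigma centralizes_con_cent_sigma central_congruence_subset in auto)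
qed

end
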